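(* In the standing setting of the context, let $q_0\in(0,1)^m$ be a probability vector and assume: (a) there exists an open neighborhood $\mathcal{N}(q_0)\subset(0,1)^m$ of $q_0$ such that, for any $t\in\mathcal{N}(q_0)$, the $\phi$-projection $s^*$ of $t$ on $\mathcal{M}=\mathcal{S}(\bar\Theta)$ exists, is unique, and satisfies $s^*=\mathcal{S}(\theta^* )$ for some (unique) $\theta^*\in\mathring\Theta$; (b) with $\vartheta^*:\mathcal{N}(q_0)\to\mathring\Theta$ defined by $\vartheta^*(t)=\operatorname*{arg\,inf}_{\theta\in\mathring\Theta}D_\phi(\mathcal{S}(\theta)\mid t)$, the $k\times k$ matrix $H(q_0)$ with entries $\frac{\partial^2 D_\phi(\mathcal{S}(\theta)\mid q_0)}{\partial\theta_i\partial\theta_j}\Big|_{\theta=\vartheta^*(q_0)}$, $i,j\in\{1,\dots,k\}$, is positive definite. Then $$\mathrm{IF}(j,\vartheta^*,q_0)=J[\vartheta^*](q_0)\,(e_j-q_0),\qquad j\in\{1,\dots,m\},$$ where $$J[\vartheta^*](q_0)=H(q_0)^{-1}\,J[\mathcal{S}](\vartheta^*(q_0))^\top\,\Delta(q_0),$$ $$\Delta(q_0)=\mathrm{diag}\left(\frac{\mathcal{S}_1(\vartheta^*(q_0))}{q_{0,1}^2}\phi''\left(\frac{\mathcal{S}_1(\vartheta^*(q_0))}{q_{0,1}}\right),\dots,\frac{\mathcal{S}_m(\vartheta^*(q_0))}{q_{0,m}^2}\phi''\left(\frac{\mathcal{S}_m(\vartheta^*(q_0))}{q_{0,m}}\ri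ght)\right).$$
   Context: Fix a positive integer $m$. The function $\phi:[0,\infty)\to\mathbb{R}$ is convex and continuous at $0$. Define $f:[0,\infty)^2\to\mathbb{R}\cup\{\infty\}$ by $f(v,w)=w\,\phi(v/w)$ if $v\ge 0$, $w>0$; $f(v,0)=v\lim_{x\to\infty}\phi(x)/x$ if $v>0$ (the limit exists in $\mathbb{R}\cup\{\infty\}$); and $f(0,0)=0$. For $s,t\in[0,\infty)^m$, $D_\phi(s\mid t)=\sum_{i=1}^m f(s_i,t_i)$. A $\phi$-projection of $t$ on a nonempty set $\mathcal{M}$ is an element $s^*\in\mathcal{M}$ with $D_\phi(s^*\mid t)=\inf_{s\in\mathcal{M}}D_\phi(s\mid t)$. A probability vector is an element of $[0,1]^m$ whose components sum to one. Standing assumptions: $\phi$ is strictly convex and twice continuously differentiable on $(0,\infty)$. For some positive integer $k\le m$, $\Theta\subset\mathbb{R}^k$ is bounded, with closure $\bar\Theta$ and nonempty interior $\mathring\Theta$; $\mathcal{S}=(\mathcal{S}_1,\dots,\mathcal{S}_m):\bar\Theta\to[0,1]^m$ is continuous, injective, twice continuously differentiable on $\mathring\Theta$, and satisfies $\mathcal{S}(\mathring\Theta)\subset(0,1)^m$; and $\mathcal{M}=\mathcal{S}(\bar\Theta)$. Influence function: for $j\in\{1,\dots,m\}$, let $e_j\in[0,1]^m$ be the vector with $1$ at position $j$ and $0$ elsewhere, and let $q_0^{[j]}(\epsilon)=(1-\epsilon)q_0+\epsilon e_j$ for real $\epsilon$ in a neighborhood of $0$ small enough that $q_0^{[j]}(\epsilon)\in\mathcal{N}(q_0)$.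 The influence function of the minimum $\phi$-divergence estimator of $q_0$ is $$\mathrm{IF}(j,\vartheta^*,q_0)=\frac{\partial\,\vartheta^*(q_0^{[j]}(\epsilon))}{\partial\epsilon}\Big|_{\epsilon=0},\qquad j\in\{1,\dots,m\}$$ (existence of this derivative is part of the assertion). $J[g](y)$ denotes the usual Jacobian matrix of $g$ at $y$; vectors in matrix expressions are one-column matrices. *)

theory Defs
  imports "HOL-Analysis.Analysis"
begin

definition strictly_convex_on :: "real set \<Rightarrow> (real \<Rightarrow> real) \<Rightarrow> bool" where
  "strictly_convex_on A f \<longleftrightarrow> convex A \<and>
     (\<forall>x\<in>A. \<forall>y\<in>A. \<forall>u. x \<noteq> y \<longrightarrow> 0 < u \<longrightarrow> u < 1 \<longrightarrow>
        f ((1 - u) * x + u * y) < (1 - u) * f x + u * f y)"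

(* Meant for open U: the two-sided derivatives in "at x" are full Frechet derivatives,
   F' and F'' being the first and second derivatives with the operator norm topology. *)
definition twice_continuously_differentiable_on ::
    "('a::real_normed_vector \<Rightarrow> 'b::real_normed_vector) \<Rightarrow> 'a set \<Rightarrow> bool" where
  "twice_continuously_differentiable_on F U \<longleftrightarrow>
     (\<exists>(F' :: 'a \<Rightarrow> 'a \<Rightarrow>\<^sub>L 'b) (F'' :: 'a \<Rightarrow> 'a \<Rightarrow>\<^sub>L ('a \<Rightarrow>\<^sub>L 'b)).
        (\<forall>x\<in>U. (F has_derivative blinfun_apply (F' x)) (at x)) \<and>
        (\<forall>x\<in>U. (F' has_derivative blinfun_apply (F'' x)) (at x)) \<and>
        continuous_on U F'')"

(* Functions on [0,\<infinity>) are represented by functions on the whole real line; values of \<phi> at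
   negative arguments are never used. The limit exists in the extended reals for convex \<phi>. *)
definition phi_term :: "(real \<Rightarrow> real) \<Rightarrow> real \<Rightarrow> real \<Rightarrow> ereal" where
  "phi_term \<phi> v w =
     (if w > 0 then ereal (w * \<phi> (v / w))
      else if v > 0 then ereal v * Lim at_top (\<lambda>x. ereal (\<phi> x / x))
      else 0)"

definition phi_divergence :: "(real \<Rightarrow> real) \<Rightarrow> real ^ 'm \<Rightarrow> real ^ 'm \<Rightarrow> ereal" where
  "phi_divergence \<phi> s t = (\<Sum>i\<in>UNIV. phi_term \<phi> (s $ i) (t $ i))"

definition is_phi_projection ::
    "(real \<Rightarrow> real) \<Rightarrow> real ^ 'm \<Rightarrow> (real ^ 'm) set \<Rightarrow> real ^ 'm \<Rightarrow> bool" where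
  "is_phi_projection \<phi> t M s \<longleftrightarrow>
     s \<in> M \<and> phi_divergence \<phi> s t = (INF s'\<in>M. phi_divergence \<phi> s' t)"

definition probability_vector :: "real ^ 'm \<Rightarrow> bool" where
  "probability_vector q \<longleftrightarrow> (\<forall>i. 0 \<le> q $ i \<and> q $ i \<le> 1) \<and> (\<Sum>i\<in>UNIV. q $ i) = 1"

definition min_phi_estimator ::
    "(real \<Rightarrow> real) \<Rightarrow> (real ^ 'k \<Rightarrow> real ^ 'm) \<Rightarrow> (real ^ 'k) set \<Rightarrow> real ^ 'm \<Rightarrow> real ^ 'k" where
  "min_phi_estimator \<phi> S \<Theta> t = arg_min_on (\<lambda>\<theta>. phi_divergence \<phi> (S \<theta>) t) (interior \<Theta>)"

definition partial_deriv :: "'k \<Rightarrow> (real ^ 'k \<Rightarrow> real) \<Rightarrow> real ^ 'k \<Rightarrow> real" where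
  "partial_deriv i g x = deriv (\<lambda>h. g (x + h *\<^sub>R axis i 1)) 0"

definition hessian :: "(real ^ 'k \<Rightarrow> real) \<Rightarrow> real ^ 'k \<Rightarrow> real ^ 'k ^ 'k" where
  "hessian g x = (\<chi> i j. partial_deriv i (partial_deriv j g) x)"

(* The divergence is finite whenever all components of q are positive, so that
   real_of_ereal loses nothing there. *)
definition divergence_hessian ::
    "(real \<Rightarrow> real) \<Rightarrow> (real ^ 'k \<Rightarrow> real ^ 'm) \<Rightarrow> real ^ 'm \<Rightarrow> real ^ 'k \<Rightarrow> real ^ 'k ^ 'k" where
  "divergence_hessian \<phi> S q = hessian (\<lambda>\<theta>. real_of_ereal (phi_divergence \<phi> (S \<theta>) q))"

definition positive_definite :: "real ^ 'k ^ 'k \<Rightarrow> bool" where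
  "positive_definite A \<longleftrightarrow> transpose A = A \<and> (\<forall>x. x \<noteq> 0 \<longrightarrow> 0 < x \<bullet> (A *v x))"

definition diag_matrix :: "real ^ 'm \<Rightarrow> real ^ 'm ^ 'm" where
  "diag_matrix d = (\<chi> i j. if i = j then d $ i else 0)"

definition weight_matrix :: "(real \<Rightarrow> real) \<Rightarrow> real ^ 'm \<Rightarrow> real ^ 'm \<Rightarrow> real ^ 'm ^ 'm" where
  "weight_matrix \<phi> s q =
     diag_matrix (\<chi> i. s $ i / (q $ i)\<^sup>2 * deriv (deriv \<phi>) (s $ i / q $ i))"

definition contaminated :: "real ^ 'm \<Rightarrow> 'm \<Rightarrow> real \<Rightarrow> real ^ 'm" where
  "contaminated q j \<epsilon> = (1 - \<epsilon>) *\<^sub>R q + \<epsilon> *\<^sub>R axis j 1"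

definition influence_function ::
    "'m \<Rightarrow> (real ^ 'm \<Rightarrow> real ^ 'k) \<Rightarrow> real ^ 'm \<Rightarrow> real ^ 'k" where
  "influence_function j \<theta> q = vector_derivative (\<lambda>\<epsilon>. \<theta> (contaminated q j \<epsilon>)) (at 0)"

end

theory Submission
  imports Defs
begin

text \<open>
  On positive \<open>t\<close> the divergence is the finite function
  \<open>\<Sum>i. t\<^sub>i \<phi>(S\<^sub>i(\<theta>) / t\<^sub>i)\<close>, and the minimum \<open>\<theta>s t\<close> is interior, so
  \<open>\<theta>s\<close> solves the score equation \<open>g(t, \<theta>s t) = 0\<close>, where \<open>g\<close> is the
  gradient in \<open>\<theta>\<close>. Compactness of the closure of \<open>\<Theta>\<close> and uniqueness of the minimiser
  make \<open>\<theta>s\<close> continuous at \<open>q0\<close>. A continuous solution of an equation whose left-hand side is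
  differentiable at the single point \<open>(q0, \<theta>s q0)\<close>, with invertible partial derivative \<open>H\<close>
  in \<open>\<theta>\<close>, is differentiable there; no implicit function theorem is needed.
\<close>

text \<open>The definition supplies operator-valued derivatives, whereas Jacobians are built from
  \<open>frechet_derivative\<close>. Uniqueness of derivatives makes both agree on the open set
  \<open>U\<close>, and evaluation at a fixed \<open>v\<close> turns the second derivative into that
  of an ordinary vector-valued map.\<close>

lemma twice_continuously_differentiable_onD:
  assumes "twice_continuously_differentiable_on F U" "open U" "x \<in> U"
  shows "(F has_derivative frechet_derivative F (at x)) (at x)"
    and "(\<lambda>y. frechet_derivative F (at y) v) differentiable (at x)"
proof -
  from assms(1) obtain F' :: "'a \<Rightarrow> 'a \<Rightarrow>\<^sub>L 'b" and F'' :: "'a \<Rightarrow> 'a \<Rightarrow>\<^sub>L ('a \<Rightarrow>\<^sub>L 'b)"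
    where F': "\<And>y. y \<in> U \<Longrightarrow> (F has_derivative blinfun_apply (F' y)) (at y)"
      and F'': "\<And>y. y \<in> U \<Longrightarrow> (F' has_derivative blinfun_apply (F'' y)) (at y)"
    unfolding twice_continuously_differentiable_on_def by blast
  have eq: "frechet_derivative F (at y) = blinfun_apply (F' y)" if "y \<in> U" for y
    using frechet_derivative_at[OF F'[OF that]] by simp
  show "(F has_derivative frechet_derivative F (at x)) (at x)"
    using F'[OF assms(3)] eq[OF assms(3)] by simp
  have "((\<lambda>y. blinfun_apply (F' y) v) has_derivative (\<lambda>h. blinfun_apply (F'' x h) v)) (at x)"
    by (auto intro!: derivative_eq_intros F''[OF assms(3)])
  then have "((\<lambda>y. frechet_derivative F (at y) v) has_derivative (\<lambda>h. blinfun_apply (F'' x h) v)) (at x)"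
    by (rule has_derivative_transform_within_open[OF _ assms(2,3)]) (simp add: eq)
  then show "(\<lambda>y. frechet_derivative F (at y) v) differentiable (at x)"
    by (rule differentiableI)
qed

lemma twice_continuously_differentiable_on_realD:
  fixes f :: "real \<Rightarrow> real"
  assumes "twice_continuously_differentiable_on f U" "open U" "x \<in> U"
  shows "(f has_real_derivative deriv f x) (at x)"
    and "(deriv f has_real_derivative deriv (deriv f) x) (at x)"
proof -
  have 1: "(f has_real_derivative deriv f y) (at y)" if "y \<in> U" for y
    using twice_continuously_differentiable_onD(1)[OF assms(1,2) that]
    by (meson DERIV_deriv_iff_real_differentiable differentiableI)
  show "(f has_real_derivative deriv f x) (at x)"
    by (rule 1[OF assms(3)])
  have eq: "frechet_derivative f (at y) 1 = deriv f y" if "y \<in> U" for y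
    using frechet_derivative_at[OF 1[OF that, unfolded has_field_derivative_def]] by (metis mult.right_neutral)
  obtain D where "((\<lambda>y. frechet_derivative f (at y) 1) has_derivative D) (at x)"
    using twice_continuously_differentiable_onD(2)[OF assms] unfolding differentiable_def by blast
  then have "(deriv f has_derivative D) (at x)"
    by (rule has_derivative_transform_within_open[OF _ assms(2,3)]) (simp add: eq)
  then show "(deriv f has_real_derivative deriv (deriv f) x) (at x)"
    by (meson DERIV_deriv_iff_real_differentiable differentiableI)
qed

text \<open>If \<open>m\<close> were discontinuous at \<open>q\<close>, some sequence
  \<open>t n\<close> would tend to \<open>q\<close> with \<open>m (t n)\<close> staying away from
  \<open>m q\<close>. By compactness a subsequence of \<open>m (t n)\<close> has a limit
  \<open>l\<close> in \<open>K\<close>. Joint continuity carries the inequality between the values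
  at \<open>m (t n)\<close> and at \<open>m q\<close> to the limit, so
  \<open>f q l \<le> f q (m q)\<close> and uniqueness forces \<open>l = m q\<close>.\<close>

lemma continuous_at_unique_minimiser:
  fixes f :: "'a::metric_space \<Rightarrow> 'b::metric_space \<Rightarrow> real"
  assumes "compact K" "open N" "q \<in> N"
    and cont: "continuous_on (N \<times> K) (\<lambda>(t, x). f t x)"
    and min: "\<And>t x. t \<in> N \<Longrightarrow> x \<in> K \<Longrightarrow> f t (m t) \<le> f t x"
    and in_K: "\<And>t. t \<in> N \<Longrightarrow> m t \<in> K"
    and unique: "\<And>x. x \<in> K \<Longrightarrow> f q x \<le> f q (m q) \<Longrightarrow> x = m q"
  shows "isCont m q"
proof (rule ccontr)
  assume "\<not> isCont m q"
  then obtain e where "e > 0" and e: "\<And>d. d > 0 \<Longrightarrow> \<exists>t. dist t q < d \<and> e \<le> dist (m t) (m q)"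
    unfolding continuous_at_eps_delta by (meson not_le)
  obtain r where "r > 0" and r: "\<And>t. dist t q < r \<Longrightarrow> t \<in> N"
    using assms(2,3) unfolding open_dist by blast
  \<comment> \<open>The bound \<open>r\<close> keeps the sequence inside \<open>N\<close>;
    \<open>inverse (Suc n)\<close> makes it converge to \<open>q\<close>.\<close>
  have "\<exists>t. dist t q < min r (inverse (Suc n)) \<and> e \<le> dist (m t) (m q)" for n
    by (rule e) (use \<open>r > 0\<close> in auto)
  then obtain t where t: "\<And>n. dist (t n) q < min r (inverse (Suc n))"
    and far: "\<And>n. e \<le> dist (m (t n)) (m q)"
    by metis
  have tN: "t n \<in> N" for n
    using t[of n] by (intro r) simp
  have "(\<lambda>n. dist (t n) q) \<longlonglongrightarrow> 0"
    by (rule tendsto_sandwich[OF _ _ tendsto_const LIMSEQ_inverse_real_of_nat])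
      (use t in \<open>auto intro!: always_eventually less_imp_le\<close>)
  then have tlim: "t \<longlonglongrightarrow> q"
    by (rule tendsto_dist_iff[THEN iffD2])
  obtain l s where "l \<in> K" "strict_mono s" and lim: "((\<lambda>n. m (t n)) \<circ> s) \<longlonglongrightarrow> l"
    using assms(1) in_K[OF tN] unfolding compact_def by meson
  have tslim: "(t \<circ> s) \<longlonglongrightarrow> q"
    using tlim \<open>strict_mono s\<close> by (rule LIMSEQ_subseq_LIMSEQ)
  have conv: "(\<lambda>n. f (t (s n)) (u n)) \<longlonglongrightarrow> f q v" if "u \<longlonglongrightarrow> v" "v \<in> K" "\<And>n. u n \<in> K" for u v
    using continuous_on_tendsto_compose[OF cont, of "\<lambda>n. (t (s n), u n)" "(q, v)" sequentially]
      tendsto_Pair[OF tslim that(1)] that(2,3) tN \<open>q \<in> N\<close>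
    by (simp add: o_def)
  have "f q l \<le> f q (m q)"
  proof (rule LIMSEQ_le)
    show "(\<lambda>n. f (t (s n)) (m (t (s n)))) \<longlonglongrightarrow> f q l"
      using lim \<open>l \<in> K\<close> in_K tN by (intro conv) (simp_all add: o_def)
    show "(\<lambda>n. f (t (s n)) (m q)) \<longlonglongrightarrow> f q (m q)"
      using in_K \<open>q \<in> N\<close> by (intro conv) simp_all
    show "\<exists>N. \<forall>n\<ge>N. f (t (s n)) (m (t (s n))) \<le> f (t (s n)) (m q)"
      using min tN in_K \<open>q \<in> N\<close> by blast
  qed
  then have "l = m q"
    using unique \<open>l \<in> K\<close> by blast
  with lim have "(\<lambda>n. dist (m (t (s n))) (m q)) \<longlonglongrightarrow> 0"
    unfolding tendsto_dist_iff[of _ l] by (simp add: o_def)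
  then have "e \<le> 0"
    by (rule LIMSEQ_le_const) (use far in blast)
  with \<open>e > 0\<close> show False by simp
qed

text \<open>Along the graph of \<open>m\<close> the function \<open>g\<close> vanishes, so
  \<open>L (t - q, m t - m q)\<close> is small compared with
  \<open>norm (t - q) + norm (m t - m q)\<close>. Applying \<open>B\<close>, a left inverse of the
  partial derivative in the second variable, isolates \<open>m t - m q\<close>. The error still
  involves \<open>m t - m q\<close>; a first crude estimate gives a Lipschitz bound at
  \<open>q\<close>, which then reduces the error to \<open>o(norm (t - q))\<close>.\<close>

lemma has_derivative_implicit_solution:
  fixes g :: "'a::real_normed_vector \<times> 'b::real_normed_vector \<Rightarrow> 'c::real_normed_vector"
  assumes g: "(g has_derivative L) (at (q, m q))"
    and zero: "eventually (\<lambda>t. g (t, m t) = 0) (nhds q)"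
    and cont: "isCont m q"
    and B: "bounded_linear B" "\<And>y. B (L (0, y)) = y"
  shows "(m has_derivative (\<lambda>h. - B (L (h, 0)))) (at q)"
proof -
  interpret L: bounded_linear L using g by (rule has_derivative_bounded_linear)
  interpret B: bounded_linear B by (rule B)
  have bl: "bounded_linear (\<lambda>h. - B (L (h, 0)))"
    by (intro bounded_linear_minus bounded_linear_compose[OF B(1)]
        bounded_linear_compose[OF L.bounded_linear_axioms] bounded_linear_Pair
        bounded_linear_ident bounded_linear_zero)
  obtain K where "K > 0" and K: "\<And>x. norm (B x) \<le> norm x * K"
    using B.pos_bounded by blast
  obtain C where "C > 0" and C: "\<And>h. norm (- B (L (h, 0))) \<le> norm h * C"
    using bounded_linear.pos_bounded[OF bl] by blast
  have gq: "g (q, m q) = 0"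
    using zero eventually_nhds_x_imp_x by fastforce
  have key: "eventually (\<lambda>t. norm (m t - m q + B (L (t - q, 0))) \<le> e * (norm (t - q) + norm (m t - m q))) (nhds q)"
    if "e > 0" for e
  proof -
    \<comment> \<open>The tolerance \<open>e / K\<close> compensates the factor \<open>K\<close>
      that \<open>B\<close> introduces.\<close>
    have "e / K > 0" using \<open>K > 0\<close> \<open>e > 0\<close> by simp
    then obtain d where "d > 0" and d: "\<And>p. norm (p - (q, m q)) < d \<Longrightarrow>
        norm (g p - g (q, m q) - L (p - (q, m q))) \<le> e / K * norm (p - (q, m q))"
      using g unfolding has_derivative_at_alt by blast
    \<comment> \<open>Continuity of \<open>m\<close> enters here: the expansion of \<open>g\<close>
      is local, so \<open>(t, m t)\<close> has to stay near \<open>(q, m q)\<close>.\<close>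
    have "((\<lambda>t. (t, m t)) \<longlongrightarrow> (q, m q)) (nhds q)"
      using cont by (intro tendsto_Pair filterlim_ident) (simp add: isCont_def tendsto_nhds_iff)
    then have "eventually (\<lambda>t. dist (t, m t) (q, m q) < d) (nhds q)"
      using \<open>d > 0\<close> by (rule tendstoD)
    with zero show ?thesis
    proof eventually_elim
      case (elim t)
      have split: "L (t - q, m t - m q) = L (t - q, 0) + L (0, m t - m q)"
        using L.add[of "(t - q, 0)" "(0, m t - m q)"] by simp
      have "norm (m t - m q + B (L (t - q, 0))) = norm (B (L (t - q, m t - m q)))"
        unfolding split by (simp add: B.add B(2) add.commute)
      also have "\<dots> \<le> norm (L (t - q, m t - m q)) * K" by (rule K)
      also have "\<dots> \<le> (e / K * norm (t - q, m t - m q)) * K"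
        using d[of "(t, m t)"] elim gq \<open>K > 0\<close> by (intro mult_right_mono) (simp_all add: dist_norm)
      also have "\<dots> = e * norm (t - q, m t - m q)" using \<open>K > 0\<close> by simp
      also have "\<dots> \<le> e * (norm (t - q) + norm (m t - m q))"
        using \<open>e > 0\<close> by (intro mult_left_mono norm_Pair_le) simp
      finally show ?case .
    qed
  qed
  \<comment> \<open>With tolerance 1/2, half of \<open>norm (m t - m q)\<close> is absorbed on the
    left. What remains is \<open>(1/2 + C) * norm (t - q)\<close>, and doubling gives the constant
    \<open>2 * C + 1\<close>.\<close>
  have lip: "eventually (\<lambda>t. norm (m t - m q) \<le> (2 * C + 1) * norm (t - q)) (nhds q)"
  proof (rule eventually_mono[OF key[of "1/2"]])
    fix t assume a: "norm (m t - m q + B (L (t - q, 0))) \<le> 1/2 * (norm (t - q) + norm (m t - m q))"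
    have "norm (m t - m q) \<le> norm (m t - m q + B (L (t - q, 0))) + norm (- B (L (t - q, 0)))"
      using norm_triangle_ineq[of "m t - m q + B (L (t - q, 0))" "- B (L (t - q, 0))"] by simp
    also have "\<dots> \<le> 1/2 * (norm (t - q) + norm (m t - m q)) + norm (t - q) * C"
      using a C by (rule add_mono)
    finally show "norm (m t - m q) \<le> (2 * C + 1) * norm (t - q)"
      by (simp add: algebra_simps)
  qed simp
  show ?thesis
    unfolding has_derivative_at_alt
  proof (intro conjI allI impI bl)
    fix e :: real assume "e > 0"
    \<comment> \<open>By \<open>lip\<close> the two norms add up to at most
      \<open>1 + (2 * C + 1)\<close> times \<open>norm (t - q)\<close>, hence the divisor.\<close>
    then have "e / (2 * C + 2) > 0" using \<open>C > 0\<close> by simp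
    from key[OF this] lip
    have "eventually (\<lambda>t. norm (m t - m q + B (L (t - q, 0))) \<le> e * norm (t - q)) (nhds q)"
    proof eventually_elim
      case (elim t)
      have "e / (2 * C + 2) * (norm (t - q) + norm (m t - m q))
          \<le> e / (2 * C + 2) * (norm (t - q) + (2 * C + 1) * norm (t - q))"
        using elim(2) \<open>e > 0\<close> \<open>C > 0\<close> by (intro mult_left_mono add_left_mono) auto
      also have "\<dots> = e / (2 * C + 2) * ((2 * C + 2) * norm (t - q))"
        by (simp add: algebra_simps)
      also have "\<dots> = e * norm (t - q)" using \<open>C > 0\<close> by simp
      finally show ?case using elim(1) by linarith
    qed
    then show "\<exists>d>0. \<forall>t. norm (t - q) < d \<longrightarrow>
        norm (m t - m q - - B (L (t - q, 0))) \<le> e * norm (t - q)"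
      by (simp add: eventually_nhds_metric dist_norm)
  qed
qed

lemma phi_divergence_pos:
  assumes "\<And>i. 0 < t $ i"
  shows "phi_divergence \<phi> s t = ereal (\<Sum>i\<in>UNIV. t $ i * \<phi> (s $ i / t $ i))"
  unfolding phi_divergence_def by (simp add: phi_term_def assms)

text \<open>Components of \<open>S\<close> may vanish at boundary parameters, so continuity of
  \<phi> at 0 is part of the requirement.\<close>

lemma continuous_on_phi_sum:
  fixes S :: "'b::metric_space \<Rightarrow> real ^ 'm"
  assumes "continuous_on {0..} \<phi>" "continuous_on K S" "\<And>\<theta> i. \<theta> \<in> K \<Longrightarrow> 0 \<le> S \<theta> $ i"
    "\<And>t i. t \<in> N \<Longrightarrow> 0 < t $ i"
  shows "continuous_on (N \<times> K) (\<lambda>(t, \<theta>). \<Sum>i\<in>UNIV. t $ i * \<phi> (S \<theta> $ i / t $ i))"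
proof -
  have "continuous_on (N \<times> K) (\<lambda>p. fst p $ i * \<phi> (S (snd p) $ i / fst p $ i))" for i
  proof (intro continuous_intros continuous_on_compose2[OF assms(1)] continuous_on_compose2[OF assms(2)])
    show "\<forall>x\<in>N \<times> K. fst x $ i \<noteq> 0" using assms(4) by (metis less_irrefl mem_Times_iff)
    show "(\<lambda>p. S (snd p) $ i / fst p $ i) ` (N \<times> K) \<subseteq> {0..}"
      by (auto intro!: divide_nonneg_pos assms(3,4))
  qed auto
  then show ?thesis unfolding case_prod_beta by (intro continuous_on_sum)
qed

text \<open>The derivative in \<theta> of the divergence along \<open>v\<close>: each weight
  \<open>t $ i\<close> cancels the \<open>1 / t $ i\<close> of the inner derivative. Fixing the
  direction keeps the score real-valued, so it can be differentiated again without operator-valued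
  maps.\<close>

definition score :: "(real \<Rightarrow> real) \<Rightarrow> ('b::real_normed_vector \<Rightarrow> real ^ 'm) \<Rightarrow> 'b \<Rightarrow> real ^ 'm \<Rightarrow> 'b \<Rightarrow> real" where
  "score \<phi> S v t \<theta> = (\<Sum>i\<in>UNIV. deriv \<phi> (S \<theta> $ i / t $ i) * frechet_derivative S (at \<theta>) v $ i)"

lemma has_derivative_phi_sum:
  assumes "(S has_derivative frechet_derivative S (at \<theta>)) (at \<theta>)"
    and "\<And>x. 0 < x \<Longrightarrow> (\<phi> has_real_derivative deriv \<phi> x) (at x)"
    and "\<And>i. 0 < S \<theta> $ i" "\<And>i. 0 < t $ i"
  shows "((\<lambda>\<theta>. \<Sum>i\<in>UNIV. t $ i * \<phi> (S \<theta> $ i / t $ i)) has_derivative (\<lambda>v. score \<phi> S v t \<theta>)) (at \<theta>)"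
proof -
  have "((\<lambda>\<theta>. t $ i * \<phi> (S \<theta> $ i / t $ i)) has_derivative
      (\<lambda>v. deriv \<phi> (S \<theta> $ i / t $ i) * frechet_derivative S (at \<theta>) v $ i)) (at \<theta>)" for i
  proof -
    have "((\<lambda>\<theta>. S \<theta> $ i / t $ i) has_derivative (\<lambda>v. frechet_derivative S (at \<theta>) v $ i / t $ i)) (at \<theta>)"
      using bounded_linear.has_derivative[OF bounded_linear_compose[OF bounded_linear_divide bounded_linear_vec_nth] assms(1)] .
    from DERIV_compose_FDERIV[OF assms(2) this] show ?thesis
      using assms(3,4)[of i] by (auto intro!: has_derivative_eq_rhs[OF has_derivative_mult_right])
  qed
  then show ?thesis unfolding score_def by (intro has_derivative_sum)
qed

text \<open>The increment is \<open>h\<close> in the data and \<open>k\<close> in the parameter. The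
  data enter only through the ratios \<open>S \<theta> $ i / t $ i\<close>, treated by the quotient
  rule; \<open>D\<close> carries the second derivative of \<open>S\<close>.\<close>

lemma has_derivative_score:
  assumes "(S has_derivative S') (at \<theta>)"
    and D: "((\<lambda>\<theta>. frechet_derivative S (at \<theta>) v) has_derivative D) (at \<theta>)"
    and "\<And>x. 0 < x \<Longrightarrow> (deriv \<phi> has_real_derivative deriv (deriv \<phi>) x) (at x)"
    and "\<And>i. 0 < S \<theta> $ i" "\<And>i. 0 < t $ i"
  shows "((\<lambda>(t, \<theta>). score \<phi> S v t \<theta>) has_derivative
      (\<lambda>(h, k). \<Sum>i\<in>UNIV. deriv \<phi> (S \<theta> $ i / t $ i) * D k $ i +
         deriv (deriv \<phi>) (S \<theta> $ i / t $ i) * (S' k $ i / t $ i - S \<theta> $ i * h $ i / (t $ i)\<^sup>2) * S' v $ i)) (at (t, \<theta>))"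
proof -
  have eq: "frechet_derivative S (at \<theta>) = S'"
    using frechet_derivative_at[OF assms(1)] by simp
  have "((\<lambda>p. deriv \<phi> (S (snd p) $ i / fst p $ i) * frechet_derivative S (at (snd p)) v $ i) has_derivative
      (\<lambda>p. deriv \<phi> (S \<theta> $ i / t $ i) * D (snd p) $ i +
         deriv (deriv \<phi>) (S \<theta> $ i / t $ i) * (S' (snd p) $ i / t $ i - S \<theta> $ i * fst p $ i / (t $ i)\<^sup>2) * S' v $ i)) (at (t, \<theta>))" for i
  proof -
    have t: "((\<lambda>p. fst p $ i) has_derivative (\<lambda>p. fst p $ i)) (at (t, \<theta>))"
      by (rule bounded_linear_imp_has_derivative[OF bounded_linear_compose[OF bounded_linear_vec_nth bounded_linear_fst]])
    have snd: "(snd has_derivative snd) (at (t, \<theta>))"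
      by (rule bounded_linear_imp_has_derivative[OF bounded_linear_snd])
    have S: "((\<lambda>p. S (snd p) $ i) has_derivative (\<lambda>p. S' (snd p) $ i)) (at (t, \<theta>))"
      by (rule bounded_linear.has_derivative[OF bounded_linear_vec_nth has_derivative_compose[OF snd]]) (simp add: assms)
    have D': "((\<lambda>p. frechet_derivative S (at (snd p)) v $ i) has_derivative (\<lambda>p. D (snd p) $ i)) (at (t, \<theta>))"
      by (rule bounded_linear.has_derivative[OF bounded_linear_vec_nth has_derivative_compose[OF snd, of "\<lambda>\<theta>. frechet_derivative S (at \<theta>) v"]]) (simp add: assms)
    have "((\<lambda>p. S (snd p) $ i / fst p $ i) has_derivative
        (\<lambda>p. S' (snd p) $ i / t $ i - S \<theta> $ i * fst p $ i / (t $ i)\<^sup>2)) (at (t, \<theta>))"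
      using assms(5)[of i]
      by (intro has_derivative_eq_rhs[OF has_derivative_divide'[OF S t]])
        (auto simp: fun_eq_iff field_simps power2_eq_square)
    from has_derivative_mult[OF DERIV_compose_FDERIV[OF assms(3) this] D']
    show ?thesis
      using assms(4,5)[of i] by (simp add: eq mult_ac)
  qed
  then show ?thesis
    unfolding score_def case_prod_beta by (intro has_derivative_sum)
qed

lemma partial_deriv_has_derivative:
  assumes "(g has_derivative g') (at x)"
  shows "partial_deriv i g x = g' (axis i 1)"
proof -
  interpret bounded_linear g' using assms by (rule has_derivative_bounded_linear)
  have "((\<lambda>h. g (x + h *\<^sub>R axis i 1)) has_derivative (\<lambda>h. g' (h *\<^sub>R axis i 1))) (at 0)"
    by (rule has_derivative_compose[where f = "\<lambda>h. x + h *\<^sub>R axis i 1" and g = g])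
      (auto intro!: derivative_eq_intros assms)
  then have "((\<lambda>h. g (x + h *\<^sub>R axis i 1)) has_real_derivative g' (axis i 1)) (at 0)"
    unfolding has_field_derivative_def by (simp add: scaleR mult.commute[of _ "g' (axis i 1)"])
  then show ?thesis unfolding partial_deriv_def by (rule DERIV_imp_deriv)
qed

text \<open>\<open>A *v y = 0\<close> makes the quadratic form vanish at \<open>y\<close>, so the
  kernel is trivial and the square matrix is invertible. Only then is the choice in
  \<open>matrix_inv\<close> known to return an inverse.\<close>

lemma positive_definite_matrix_inv:
  assumes "positive_definite A"
  shows "matrix_inv A *v (A *v x) = x"
proof -
  have "A *v y = 0 \<Longrightarrow> y = 0" for y
    using assms unfolding positive_definite_def by (metis inner_zero_right less_irrefl)
  then have "\<exists>B. B ** A = mat 1"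
    by (simp add: matrix_left_invertible_ker)
  then have "invertible A" by (simp add: invertible_left_inverse)
  then have "matrix_inv A ** A = mat 1"
    unfolding invertible_def matrix_inv_def by (rule someI2_ex) simp
  then show ?thesis by (simp add: matrix_vector_mul_assoc)
qed


theorem corollary33:
  fixes \<phi> :: "real \<Rightarrow> real"
    and \<Theta> :: "(real ^ 'k) set"
    and S :: "real ^ 'k \<Rightarrow> real ^ 'm"
    and q0 :: "real ^ 'm"
    and N :: "(real ^ 'm) set"
    and \<theta>s :: "real ^ 'm \<Rightarrow> real ^ 'k"
  assumes "convex_on {0..} \<phi>"
    and "continuous (at 0 within {0..}) \<phi>"
    and "strictly_convex_on {0<..} \<phi>"
    and "twice_continuously_differentiable_on \<phi> {0<..}"
    and "CARD('k) \<le> CARD('m)"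
    and "bounded \<Theta>"
    and "interior \<Theta> \<noteq> {}"
    and "\<And>\<theta> i. \<theta> \<in> closure \<Theta> \<Longrightarrow> 0 \<le> S \<theta> $ i \<and> S \<theta> $ i \<le> 1"
    and "continuous_on (closure \<Theta>) S"
    and "inj_on S (closure \<Theta>)"
    and "twice_continuously_differentiable_on S (interior \<Theta>)"
    and "\<And>\<theta> i. \<theta> \<in> interior \<Theta> \<Longrightarrow> 0 < S \<theta> $ i \<and> S \<theta> $ i < 1"
    and "probability_vector q0"
    and "\<And>i. 0 < q0 $ i \<and> q0 $ i < 1"
    and "open N"
    and "q0 \<in> N"
    and "\<And>t i. t \<in> N \<Longrightarrow> 0 < t $ i \<and> t $ i < 1"
    and "\<And>t. t \<in> N \<Longrightarrow> \<exists>!s. is_phi_projection \<phi> t (S ` closure \<Theta>) s"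
    and "\<And>t s. t \<in> N \<Longrightarrow> is_phi_projection \<phi> t (S ` closure \<Theta>) s \<Longrightarrow>
           \<exists>!\<theta>. \<theta> \<in> interior \<Theta> \<and> s = S \<theta>"
    and "\<And>t. t \<in> N \<Longrightarrow> \<theta>s t = min_phi_estimator \<phi> S \<Theta> t"
    and "positive_definite (divergence_hessian \<phi> S q0 (\<theta>s q0))"
  shows "(\<forall>j. (\<lambda>\<epsilon>. \<theta>s (contaminated q0 j \<epsilon>)) differentiable (at 0) \<and>
              influence_function j \<theta>s q0 = jacobian \<theta>s (at q0) *v (axis j 1 - q0)) \<and>
         \<theta>s differentiable (at q0) \<and>
         jacobian \<theta>s (at q0) =
           matrix_inv (divergence_hessian \<phi> S q0 (\<theta>s q0)) **
           transpose (jacobian S (at (\<theta>s q0))) **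
           weight_matrix \<phi> (S (\<theta>s q0)) q0"
proof -
  define D where "D t \<theta> = (\<Sum>i\<in>UNIV. t $ i * \<phi> (S \<theta> $ i / t $ i))" for t \<theta>
  define \<theta>0 where "\<theta>0 = \<theta>s q0"
  define H where "H = divergence_hessian \<phi> S q0 \<theta>0"
  define J where "J = jacobian S (at \<theta>0)"
  define W where "W = weight_matrix \<phi> (S \<theta>0) q0"
  note interior_closure = subsetD[OF subset_trans[OF interior_subset closure_subset]]
  note S_pos = assms(12)[THEN conjunct1]
  note N_pos = assms(17)[THEN conjunct1]
  note \<phi>_deriv = twice_continuously_differentiable_on_realD[OF assms(4) open_greaterThan, unfolded greaterThan_iff]
  note S_deriv = twice_continuously_differentiable_onD[OF assms(11) open_interior]
  have divD: "phi_divergence \<phi> (S \<theta>) t = ereal (D t \<theta>)" if "t \<in> N" for \<theta> t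
    unfolding D_def using N_pos[OF that] by (rule phi_divergence_pos)
  have \<phi>_cont: "continuous_on {0..} \<phi>"
    unfolding continuous_on_eq_continuous_within
  proof
    fix x :: real assume "x \<in> {0..}"
    then show "continuous (at x within {0..}) \<phi>"
      using assms(2) continuous_at_imp_continuous_at_within[OF DERIV_isCont[OF \<phi>_deriv(1)]]
      by (cases "x = 0") auto
  qed

  \<comment> \<open>The estimator as unique minimiser, and its continuity at
    \<open>q0\<close>\<close>
  have minimiser: "\<theta>s t \<in> interior \<Theta>"
      "\<And>\<theta>. \<theta> \<in> closure \<Theta> \<Longrightarrow> D t (\<theta>s t) \<le> D t \<theta>"
      "\<And>\<theta>. \<theta> \<in> closure \<Theta> \<Longrightarrow> D t \<theta> \<le> D t (\<theta>s t) \<Longrightarrow> \<theta> = \<theta>s t"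
    if t: "t \<in> N" for t
  proof -
    obtain s where s: "is_phi_projection \<phi> t (S ` closure \<Theta>) s"
      and s_unique: "\<And>s'. is_phi_projection \<phi> t (S ` closure \<Theta>) s' \<Longrightarrow> s' = s"
      using assms(18)[OF t] by blast
    obtain \<theta> where \<theta>: "\<theta> \<in> interior \<Theta>" "s = S \<theta>"
      using assms(19)[OF t s] by blast
    have le: "D t \<theta> \<le> D t \<theta>'" if "\<theta>' \<in> closure \<Theta>" for \<theta>'
    proof -
      have "phi_divergence \<phi> s t \<le> phi_divergence \<phi> (S \<theta>') t"
        using s that unfolding is_phi_projection_def by (auto intro!: INF_lower)
      then show ?thesis by (simp add: \<theta>(2) divD[OF t])
    qed
    \<comment> \<open>A competitor that does no worse also attains the infimum, so its image is a
      projection; uniqueness of the projection and injectivity of \<open>S\<close> identify it with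
      \<theta>.\<close>
    have unique: "\<theta>' = \<theta>" if "\<theta>' \<in> closure \<Theta>" "D t \<theta>' \<le> D t \<theta>" for \<theta>'
    proof -
      have "phi_divergence \<phi> (S \<theta>') t = phi_divergence \<phi> s t"
        using le[OF that(1)] that(2) by (simp add: \<theta>(2) divD[OF t])
      then have "is_phi_projection \<phi> t (S ` closure \<Theta>) (S \<theta>')"
        using s that(1) unfolding is_phi_projection_def by simp
      then have "S \<theta>' = S \<theta>" using s_unique \<theta>(2) by simp
      then show ?thesis
        using inj_onD[OF assms(10)] that(1) interior_closure[OF \<theta>(1)] by blast
    qed
    \<comment> \<open>The estimator minimises over the interior, the projection over the image of
      the closure. As \<theta> is interior and beats every other point of the closure, both problems
      share this unique solution, and the choice in \<open>arg_min\<close> must return it.\<close>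
    have "is_arg_min (\<lambda>\<theta>. phi_divergence \<phi> (S \<theta>) t) (\<lambda>\<theta>. \<theta> \<in> interior \<Theta>) \<theta>' \<longleftrightarrow> \<theta>' = \<theta>" for \<theta>'
      using \<theta>(1) le unique interior_closure
      unfolding is_arg_min_def divD[OF t] less_ereal.simps by (meson not_le)
    then have "\<theta>s t = \<theta>"
      unfolding assms(20)[OF t] min_phi_estimator_def arg_min_on_def arg_min_def
      by (intro some_equality) simp_all
    then show "\<theta>s t \<in> interior \<Theta>"
      "\<And>\<theta>. \<theta> \<in> closure \<Theta> \<Longrightarrow> D t (\<theta>s t) \<le> D t \<theta>"
      "\<And>\<theta>. \<theta> \<in> closure \<Theta> \<Longrightarrow> D t \<theta> \<le> D t (\<theta>s t) \<Longrightarrow> \<theta> = \<theta>s t"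
      using \<theta>(1) le unique by blast+
  qed
  have cont: "isCont \<theta>s q0"
  proof (rule continuous_at_unique_minimiser[of "closure \<Theta>" N q0 D])
    show "compact (closure \<Theta>)" using assms(6) by (simp add: compact_closure)
    show "continuous_on (N \<times> closure \<Theta>) (\<lambda>(t, \<theta>). D t \<theta>)"
      unfolding D_def using assms(8,9) N_pos \<phi>_cont by (intro continuous_on_phi_sum) auto
  qed (use assms(15,16) minimiser interior_closure[OF minimiser(1)] in auto)

  \<comment> \<open>The score equation\<close>
  have D_deriv: "(D t has_derivative (\<lambda>v. score \<phi> S v t \<theta>)) (at \<theta>)" if "t \<in> N" "\<theta> \<in> interior \<Theta>" for t \<theta>
    unfolding D_def[abs_def]
    by (intro has_derivative_phi_sum S_deriv \<phi>_deriv S_pos N_pos that)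
  have score_zero: "score \<phi> S v t (\<theta>s t) = 0" if "t \<in> N" for v t
  proof -
    have "(\<lambda>v. score \<phi> S v t (\<theta>s t)) = (\<lambda>v. 0)"
      by (rule differential_zero_maxmin[OF minimiser(1)[OF that] open_interior D_deriv[OF that minimiser(1)[OF that]]])
        (use minimiser(2)[OF that] interior_closure in blast)
    then show ?thesis by (rule fun_cong)
  qed
  have \<theta>0: "\<theta>0 \<in> interior \<Theta>" unfolding \<theta>0_def by (rule minimiser(1)[OF assms(16)])

  \<comment> \<open>The joint derivative of the score at \<open>(q0, \<theta>0)\<close>\<close>
  have S_has: "(S has_derivative (\<lambda>h. J *v h)) (at \<theta>0)"
    unfolding J_def
    by (rule jacobian_works[THEN iffD1, OF differentiableI[OF S_deriv(1)[OF \<theta>0]]])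
  have "\<exists>D. ((\<lambda>\<theta>. frechet_derivative S (at \<theta>) (axis j 1)) has_derivative D) (at \<theta>0)" for j
    using S_deriv(2)[OF \<theta>0] unfolding differentiable_def by blast
  then obtain SD where SD: "\<And>j. ((\<lambda>\<theta>. frechet_derivative S (at \<theta>) (axis j 1)) has_derivative SD j) (at \<theta>0)"
    by metis
  define L where "L j = (\<lambda>(h, k). \<Sum>i\<in>UNIV. deriv \<phi> (S \<theta>0 $ i / q0 $ i) * SD j k $ i +
         deriv (deriv \<phi>) (S \<theta>0 $ i / q0 $ i) * ((J *v k) $ i / q0 $ i - S \<theta>0 $ i * h $ i / (q0 $ i)\<^sup>2)
           * (J *v axis j 1) $ i)" for j
  have score_deriv: "((\<lambda>(t, \<theta>). score \<phi> S (axis j 1) t \<theta>) has_derivative L j) (at (q0, \<theta>0))" for j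
    unfolding L_def using assms(14)
    by (intro has_derivative_score S_has SD \<phi>_deriv S_pos[OF \<theta>0]) auto
  have L_lin: "linear (L j)" for j
    using score_deriv by (rule has_derivative_linear)
  have L_hess: "L j (0, axis i 1) = H $ i $ j" for i j
  proof -
    have eq: "score \<phi> S (axis j 1) q0 \<theta> = partial_deriv j (D q0) \<theta>" if "\<theta> \<in> interior \<Theta>" for \<theta>
      using partial_deriv_has_derivative[OF D_deriv[OF assms(16) that]] by simp
    have "((\<lambda>\<theta>. (q0, \<theta>)) has_derivative (\<lambda>k. (0, k))) (at \<theta>0)"
      by (intro has_derivative_Pair has_derivative_const has_derivative_ident)
    from has_derivative_compose[OF this score_deriv]
    have "((\<lambda>\<theta>. score \<phi> S (axis j 1) q0 \<theta>) has_derivative (\<lambda>k. L j (0, k))) (at \<theta>0)"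
      by simp
    \<comment> \<open>The score is identified with the partial derivative on the interior only,
      which suffices because differentiation is local.\<close>
    then have "(partial_deriv j (D q0) has_derivative (\<lambda>k. L j (0, k))) (at \<theta>0)"
      by (rule has_derivative_transform_within_open[OF _ open_interior \<theta>0]) (rule eq)
    from partial_deriv_has_derivative[OF this] show ?thesis
      by (simp add: H_def divergence_hessian_def hessian_def divD[OF assms(16)])
  qed
  \<comment> \<open>In \<open>hessian\<close> the first index is the outer derivative, so
    \<open>L j\<close> yields column \<open>j\<close> of \<open>H\<close>, while component
    \<open>j\<close> of \<open>H *v k\<close> uses row \<open>j\<close>. The symmetry bridging this
    is contained in \<open>positive_definite\<close>.\<close>
  have H_sym: "H $ i $ j = H $ j $ i" for i j
    using assms(21) unfolding positive_definite_def H_def \<theta>0_def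
    by (metis transpose_def vec_lambda_beta)
  have L_theta: "(\<chi> j. L j (0, k)) = H *v k" for k
  proof -
    have "L j (0, k) = (\<Sum>i\<in>UNIV. H $ j $ i * k $ i)" for j
    proof -
      have lin: "linear (\<lambda>k. L j (0, k))"
        using linear_compose[OF _ L_lin, of "\<lambda>k. (0, k)"] by (simp add: o_def linear_iff)
      have "L j (0, k) = (\<Sum>i\<in>UNIV. k $ i * L j (0, axis i 1))"
        by (subst basis_expansion[of k, symmetric])
          (simp add: linear_sum[OF lin] linear_scale[OF lin] scalar_mult_eq_scaleR del: basis_expansion)
      then show ?thesis by (simp add: L_hess H_sym[of _ j] mult.commute)
    qed
    then show ?thesis by (simp add: matrix_vector_mult_def)
  qed
  \<comment> \<open>With no parameter increment the second-derivative term of \<open>S\<close> drops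
    out, leaving the derivative of the ratios in the data. Its minus sign will cancel the one in the
    implicit derivative.\<close>
  have L_data: "(\<chi> j. L j (h, 0)) = - (transpose J *v (W *v h))" for h
  proof -
    have "linear (SD j)" for j using SD by (rule has_derivative_linear)
    then have "SD j 0 = 0" for j by (rule linear_0)
    moreover have "(W *v h) $ i = S \<theta>0 $ i / (q0 $ i)\<^sup>2 * deriv (deriv \<phi>) (S \<theta>0 $ i / q0 $ i) * h $ i" for i
      by (simp add: W_def weight_matrix_def diag_matrix_def matrix_vector_mult_def if_distrib[of "\<lambda>x. x * _"] cong: if_cong)
    ultimately show ?thesis
      by (simp add: L_def vec_eq_iff matrix_vector_mult_basis column_def transpose_def
          matrix_vector_mult_def[of "\<chi> i j. J $ j $ i"] sum_negf[symmetric] mult_ac)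
  qed

  \<comment> \<open>Differentiability of the estimator and the influence function\<close>
  have grad: "((\<lambda>(t, \<theta>). \<chi> j. score \<phi> S (axis j 1) t \<theta>) has_derivative (\<lambda>p. \<chi> j. L j p)) (at (q0, \<theta>s q0))"
    unfolding has_derivative_componentwise_within[where f' = "\<lambda>p. \<chi> j. L j p"] Basis_vec_def
    using score_deriv[unfolded case_prod_beta \<theta>0_def] by (auto simp: inner_axis case_prod_beta)
  have inv: "matrix_inv H *v (H *v k) = k" for k
    using assms(21) unfolding H_def \<theta>0_def by (rule positive_definite_matrix_inv)
  have zero: "\<forall>\<^sub>F t in nhds q0. (\<lambda>(t, \<theta>). \<chi> j. score \<phi> S (axis j 1) t \<theta>) (t, \<theta>s t) = 0"
    using eventually_nhds_in_open[OF assms(15,16)]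
    by eventually_elim (simp add: score_zero vec_eq_iff)
  \<comment> \<open>On pure parameter increments the derivative of the score vector is
    \<open>H\<close>, so \<open>matrix_inv H\<close> serves as the left inverse
    \<open>B\<close>.\<close>
  have "(\<theta>s has_derivative (\<lambda>h. - (matrix_inv H *v (\<chi> j. L j (h, 0))))) (at q0)"
    by (rule has_derivative_implicit_solution[OF grad zero cont matrix_vector_mul_bounded_linear])
      (simp add: L_theta inv)
  then have \<theta>s_deriv: "(\<theta>s has_derivative (\<lambda>h. (matrix_inv H ** transpose J ** W) *v h)) (at q0)"
    by (simp add: L_data linear_neg[OF matrix_vector_mul_linear] matrix_vector_mul_assoc matrix_mul_assoc)
  have jac: "jacobian \<theta>s (at q0) = matrix_inv H ** transpose J ** W"
    unfolding jacobian_def frechet_derivative_at[OF \<theta>s_deriv, symmetric] by simp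
  have infl: "((\<lambda>\<epsilon>. \<theta>s (contaminated q0 j \<epsilon>)) has_vector_derivative
      jacobian \<theta>s (at q0) *v (axis j 1 - q0)) (at 0)" for j
  proof -
    \<comment> \<open>The contamination path is affine, passing through \<open>q0\<close> at 0 with
      velocity \<open>axis j 1 - q0\<close>; the chain rule does the rest.\<close>
    have c: "(contaminated q0 j has_derivative (\<lambda>h. h *\<^sub>R (axis j 1 - q0))) (at 0)"
      unfolding contaminated_def[abs_def]
      by (auto intro!: derivative_eq_intros simp: algebra_simps)
    have "((\<lambda>\<epsilon>. \<theta>s (contaminated q0 j \<epsilon>)) has_derivative
        (\<lambda>h. jacobian \<theta>s (at q0) *v (h *\<^sub>R (axis j 1 - q0)))) (at 0)"
      by (rule has_derivative_compose[OF c]) (simp add: contaminated_def jac \<theta>s_deriv)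
    then show ?thesis
      by (simp add: has_vector_derivative_def matrix_vector_mult_scaleR)
  qed
  show ?thesis
    using infl jac \<theta>s_deriv
    unfolding influence_function_def H_def J_def W_def \<theta>0_def
    by (auto intro: differentiableI vector_derivative_at simp: has_vector_derivative_def)
qed

end
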